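(* For every $z\in\mathcal A=\mathbb C\setminus(-\infty,0]$, $$ G(z)=1-\int_0^\infty\frac{\rho(t)}{z+t}\,dt, $$ where $$ \rho(t)=\begin{cases} -\dfrac{t\ln\left((1-t)/t^2\right)}{\ln(1-t)}, & 0<t<1,\\[2ex] -\dfrac{t\left(\ln\left((t-1)/t\right)\right)^2}{(\ln(t-1))^2+\pi^2}, & 1<t<\infty. \end{cases} $$
   Context: Let $\mathcal A=\mathbb C\setminus(-\infty,0]$ be the cut plane and let $\operatorname{Log} z=\ln|z|+i\operatorname{Arg} z$ be the principal logarithm on $\mathcal A$, with $-\pi<\operatorname{Arg} z<\pi$. The function $G$ is the holomorphic function on $\mathcal A$ defined by $$ G(z)=\left(1-\frac{\operatorname{Log} z}{\operatorname{Log}(1+z)}\right)z\operatorname{Log} z,\quad z\in\mathcal A. $$ *)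

theory Defs
  imports "HOL-Analysis.Analysis"
begin

definition cut_plane :: "complex set" where
  "cut_plane = - \<real>\<^sub>\<le>\<^sub>0"

(* On the cut plane the library's principal logarithm Ln has imaginary part strictly
   between -pi and pi, and Ln (1 + z) is nonzero there, so no division by zero occurs. *)
definition G :: "complex \<Rightarrow> complex" where
  "G z = (1 - Ln z / Ln (1 + z)) * z * Ln z"

(* Outside (0,1) and (1,\<infinity>) the density is undefined; the junk value 0 at the
   single point t = 1 of the integration range does not affect the integral. *)
definition \<rho> :: "real \<Rightarrow> real" where
  "\<rho> t = (if 0 < t \<and> t < 1 then - (t * ln ((1 - t) / t\<^sup>2) / ln (1 - t))
          else if 1 < t then - (t * (ln ((t - 1) / t))\<^sup>2 / ((ln (t - 1))\<^sup>2 + pi\<^sup>2))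
          else 0)"

end

theory Submission
  imports Defs "HOL-Complex_Analysis.Complex_Analysis" "HOL-Real_Asymp.Real_Asymp"
begin

text \<open>The substitution \<open>z = exp w\<close> turns the cut plane into the open strip \<open>\<bar>Im w\<bar> < pi\<close>, a keyhole
  contour around the cut into a rectangle, and the two sides of the cut into the edges \<open>Im w = \<plusminus> pi\<close>.
  In this coordinate \<open>G\<close> extends continuously to the closed strip, so Cauchy's formula holds on
  the rectangle \<open>[-r, r] \<times> [-pi, pi]\<close> itself and no limit towards the cut is needed. As \<open>r\<close> grows, the
  left side contributes 0 (at \<open>z = 0\<close> the function has only a logarithmic singularity), the right side
  contributes \<open>G(\<infinity>) = 1\<close>, and the horizontal sides, where \<open>G\<close> takes conjugate values with
  imaginary part \<open>\<plusminus> pi * \<rho> t\<close>, give the integral of \<open>\<rho> t / (z + t)\<close>.\<close>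

section \<open>The closed strip and the logarithm of \<open>1 + exp w\<close> extended to it\<close>

definition strip :: "complex set" where
  "strip = {w. \<bar>Im w\<bar> \<le> pi}"

text \<open>The function \<open>Ln (1 + exp w)\<close>, extended continuously to the closed strip; the principal logarithm itself
  would have the wrong imaginary part on the right half of the lower edge. At the two points
  \<open>\<plusminus> \<i> * pi\<close> it is unbounded; the value 0 there makes \<open>w / strip_Ln w = 0\<close>, which is the limit.\<close>
definition strip_Ln :: "complex \<Rightarrow> complex" where
  "strip_Ln w = (if 1 + exp w = 0 then 0 else if Re w \<le> 0 then Ln (1 + exp w) else w + Ln (1 + exp (- w)))"

definition G_strip :: "complex \<Rightarrow> complex" where
  "G_strip w = (1 - w / strip_Ln w) * exp w * w"

lemma one_plus_exp_eq: "1 + exp w = exp w * (1 + exp (- w))" for w :: complex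
  by (simp add: distrib_left exp_minus)

lemma one_plus_exp_minus_eq_0_iff: "1 + exp (- w) = 0 \<longleftrightarrow> 1 + exp w = 0" for w :: complex
  using one_plus_exp_eq[of w] by simp

text \<open>The closed unit disc meets the half-plane Re u \<le> -1 only at u = -1.\<close>

lemma Re_one_plus_pos:
  fixes u :: complex
  assumes "norm u \<le> 1" "1 + u \<noteq> 0"
  shows "Re (1 + u) > 0"
proof (rule ccontr)
  assume "\<not> ?thesis"
  then have r: "Re u = -1" using assms(1) abs_Re_le_cmod[of u] by auto
  have "(Re u)\<^sup>2 + (Im u)\<^sup>2 \<le> 1"
    using assms(1) by (metis cmod_power2 norm_ge_zero power_le_one)
  then have "Im u = 0" using r by simp
  with r assms(2) show False by (simp add: complex_eq_iff)
qed

text \<open>By \<open>one_plus_exp_eq\<close> it suffices that the arguments of the two factors add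
  up without leaving (-pi, pi]. The second factor lies in the right half-plane, so its argument is
  below pi/2 in absolute value, and its sign is (weakly) opposite to that of \<open>Im w\<close>.
  The identity makes the two branches of \<open>strip_Ln\<close> agree where they meet.\<close>

lemma Ln_one_plus_exp_reflect:
  assumes w: "\<bar>Im w\<bar> < pi" and "Re w \<ge> 0"
  shows "Ln (1 + exp w) = w + Ln (1 + exp (- w))"
proof -
  have nz: "1 + exp (-w) \<noteq> 0"
  proof
    assume "1 + exp (-w) = 0"
    then have "exp w = -1"
      by (simp add: one_plus_exp_minus_eq_0_iff eq_neg_iff_add_eq_0 add.commute)
    then have "w = Ln (-1)" using Ln_exp[of w] w by auto
    then show False using w by simp
  qed
  then have re: "Re (1 + exp (-w)) > 0"
    using Re_one_plus_pos[of "exp (-w)"] assms(2) by simp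
  have "\<bar>Im (Ln (1 + exp (-w)))\<bar> < pi/2" using re Re_Ln_pos_lt_imp by blast
  moreover have "Im (Ln (1 + exp (-w))) \<le> 0" if "Im w \<ge> 0"
  proof -
    have "Im (1 + exp (-w)) \<le> 0" using that w sin_ge_zero[of "Im w"] by (simp add: Im_exp)
    then show ?thesis
      using Im_Ln_pos_lt[OF nz] Re_Ln_pos_lt_imp[OF re] by (simp add: not_less[symmetric] abs_less_iff) linarith
  qed
  moreover have "Im (Ln (1 + exp (-w))) \<ge> 0" if "Im w \<le> 0"
  proof -
    have "Im (1 + exp (-w)) \<ge> 0" using that w sin_ge_zero[of "- Im w"] by (simp add: Im_exp mult_nonneg_nonpos)
    then show ?thesis using Im_Ln_pos_le[OF nz] by blast
  qed
  ultimately have im: "-pi < Im w + Im (Ln (1 + exp (-w)))" "Im w + Im (Ln (1 + exp (-w))) \<le> pi"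
    using w pi_gt_zero by linarith+
  then show ?thesis
    using one_plus_exp_eq[of w] Ln_times_simple[of "exp w" "1 + exp (-w)"] im nz w by simp
qed

lemma exp_notin_nonpos_Reals:
  assumes "\<bar>Im w\<bar> < pi"
  shows "exp w \<notin> \<real>\<^sub>\<le>\<^sub>0"
proof
  assume "exp w \<in> \<real>\<^sub>\<le>\<^sub>0"
  then have "Re (exp w) \<le> 0" "Im (exp w) = 0" by (auto simp: complex_nonpos_Reals_iff)
  moreover have "Re (exp w) \<noteq> 0" using \<open>Im (exp w) = 0\<close> exp_not_eq_zero[of w] complex_eq_iff by auto
  ultimately have "Im (Ln (exp w)) = pi" using Im_Ln_eq_pi[of "exp w"] by auto
  moreover have "Ln (exp w) = w" using assms by (intro Ln_exp) auto
  ultimately show False using assms by simp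
qed

lemma one_plus_notin_nonpos_Reals:
  fixes z :: complex
  assumes "z \<notin> \<real>\<^sub>\<le>\<^sub>0"
  shows "1 + z \<notin> \<real>\<^sub>\<le>\<^sub>0"
  using assms by (auto simp: complex_nonpos_Reals_iff)

lemma strip_Ln_eq:
  assumes "\<bar>Im w\<bar> < pi"
  shows "strip_Ln w = Ln (1 + exp w)"
proof -
  have "1 + exp w \<noteq> 0"
    using one_plus_notin_nonpos_Reals[OF exp_notin_nonpos_Reals[OF assms]] by auto
  then show ?thesis
    using Ln_one_plus_exp_reflect[OF assms] by (simp add: strip_Ln_def)
qed

lemma exp_strip_Ln:
  assumes "1 + exp w \<noteq> 0"
  shows "exp (strip_Ln w) = 1 + exp w"
proof -
  have "1 + exp (-w) \<noteq> 0"
    using assms by (simp only: one_plus_exp_minus_eq_0_iff not_False_eq_True)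
  then show ?thesis
    using assms by (simp add: strip_Ln_def exp_add distrib_left exp_minus)
qed

text \<open>Vanishing would give \<open>1 + exp w = exp 0 = 1\<close>, that is
  \<open>exp w = 0\<close>.\<close>

lemma strip_Ln_nonzero:
  assumes "1 + exp w \<noteq> 0"
  shows "strip_Ln w \<noteq> 0"
  using exp_strip_Ln[OF assms] by auto

text \<open>The real part of any logarithm is the \<open>ln\<close> of the modulus. The bound forces
  \<open>strip_Ln\<close> to blow up near the zeros of \<open>1 + exp w\<close>; at the zeros
  themselves it is trivial by the convention \<open>ln 0 = 0\<close>.\<close>

lemma abs_ln_le_norm_strip_Ln: "\<bar>ln (norm (1 + exp w))\<bar> \<le> norm (strip_Ln w)"
proof (cases "1 + exp w = 0")
  case False
  have "norm (exp (strip_Ln w)) = norm (1 + exp w)" using exp_strip_Ln[OF False] by simp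
  then have "Re (strip_Ln w) = ln (norm (1 + exp w))" by (metis ln_exp norm_exp_eq_Re)
  then show ?thesis using abs_Re_le_cmod[of "strip_Ln w"] by simp
qed simp

lemma one_plus_exp_notin_nonpos_Reals:
  fixes w :: complex
  assumes "1 + exp w \<noteq> 0"
  shows "Re w \<le> 0 \<Longrightarrow> 1 + exp w \<notin> \<real>\<^sub>\<le>\<^sub>0"
    and "Re w \<ge> 0 \<Longrightarrow> 1 + exp (-w) \<notin> \<real>\<^sub>\<le>\<^sub>0"
  using Re_one_plus_pos[of "exp w"] Re_one_plus_pos[of "exp (-w)"] one_plus_exp_minus_eq_0_iff[of w] assms
  by (simp_all add: complex_nonpos_Reals_iff)

text \<open>The two branches are glued along the imaginary axis. On each closed half, the argument
  of \<open>Ln\<close> stays in the open right half-plane, off the branch cut.\<close>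

lemma continuous_on_strip_Ln: "continuous_on {w \<in> strip. 1 + exp w \<noteq> 0} strip_Ln"
proof -
  let ?S = "{w \<in> strip. 1 + exp w \<noteq> 0}"
  have "continuous_on ?S (\<lambda>w. if Re w \<le> 0 then Ln (1 + exp w) else w + Ln (1 + exp (- w)))"
  proof (rule continuous_on_cases_le)
    show "continuous_on {w \<in> ?S. Re w \<le> 0} (\<lambda>w. Ln (1 + exp w))"
    proof (rule continuous_on_Ln')
      show "1 + exp w \<notin> \<real>\<^sub>\<le>\<^sub>0" if "w \<in> {w \<in> ?S. Re w \<le> 0}" for w
        by (rule one_plus_exp_notin_nonpos_Reals(1)) (use that in simp_all)
    qed (intro continuous_intros)
    show "continuous_on {w \<in> ?S. 0 \<le> Re w} (\<lambda>w. w + Ln (1 + exp (- w)))"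
    proof (intro continuous_on_add continuous_on_id continuous_on_Ln')
      show "1 + exp (-w) \<notin> \<real>\<^sub>\<le>\<^sub>0" if "w \<in> {w \<in> ?S. 0 \<le> Re w}" for w
        by (rule one_plus_exp_notin_nonpos_Reals(2)) (use that in simp_all)
    qed (intro continuous_intros)+
    show "continuous_on ?S Re" by (rule continuous_on_Re[OF continuous_on_id])
    fix w assume w: "w \<in> ?S" "Re w = 0"
    \<comment> \<open>The edge points of the seam are exactly the removed zeros of
      \<open>1 + exp w\<close>, so the reflection identity for the open strip covers the whole
      seam.\<close>
    have "\<bar>Im w\<bar> \<noteq> pi"
    proof
      assume "\<bar>Im w\<bar> = pi"
      then have "Im w = pi \<or> Im w = -pi" by linarith
      then have "exp w = -1" using w(2) by (auto simp: complex_eq_iff Re_exp Im_exp)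
      then show False using w by simp
    qed
    then have "\<bar>Im w\<bar> < pi" using w by (auto simp: strip_def)
    then show "Ln (1 + exp w) = w + Ln (1 + exp (- w))"
      using w by (intro Ln_one_plus_exp_reflect) auto
  qed
  then show ?thesis
    by (rule continuous_on_eq) (simp add: strip_Ln_def)
qed

text \<open>Away from the zeros of \<open>1 + exp w\<close> this is the continuity of a nonvanishing
  function's inverse. At a zero, the inverse is squeezed by 1 / |ln r| with r =
  \<open>norm (1 + exp v)\<close> tending to 0.\<close>

lemma continuous_on_inverse_strip_Ln: "continuous_on strip (\<lambda>w. inverse (strip_Ln w))"
  unfolding continuous_on_eq_continuous_within
proof
  fix w assume w: "w \<in> strip"
  show "continuous (at w within strip) (\<lambda>w. inverse (strip_Ln w))"
  proof (cases "1 + exp w = 0")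
    case False
    have op: "open {w::complex. 1 + exp w \<noteq> 0}"
      by (intro open_Collect_neq continuous_intros)
    have "continuous_on {w \<in> strip. 1 + exp w \<noteq> 0} (\<lambda>w. inverse (strip_Ln w))"
      using strip_Ln_nonzero by (intro continuous_on_inverse continuous_on_strip_Ln) auto
    then have "continuous (at w within strip \<inter> {w. 1 + exp w \<noteq> 0}) (\<lambda>w. inverse (strip_Ln w))"
      using w False by (simp add: continuous_on_eq_continuous_within Int_def)
    then show ?thesis
      using at_within_nhd[of w "{w. 1 + exp w \<noteq> 0}" "strip \<inter> {w. 1 + exp w \<noteq> 0}" strip] op False by auto
  next
    case True
    have "((\<lambda>r::real. inverse \<bar>ln r\<bar>) \<longlongrightarrow> 0) (at_right 0)" by real_asymp
    then have lim: "((\<lambda>r::real. inverse \<bar>ln r\<bar>) \<longlongrightarrow> 0) (at 0 within {0..})"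
      by (simp add: at_within_Ici_at_right)
    have c: "continuous (at w within strip) (\<lambda>v. norm (1 + exp v))" by (intro continuous_intros)
    have "continuous (at w within strip) ((\<lambda>r. inverse \<bar>ln r\<bar>) \<circ> (\<lambda>v. norm (1 + exp v)))"
    proof (rule continuous_within_compose[OF c])
      \<comment> \<open>The conventions \<open>ln 0 = 0\<close> and \<open>inverse 0 = 0\<close>
        give the value 0 at r = 0, which is also the limit.\<close>
      have "continuous (at 0 within {0..}) (\<lambda>r::real. inverse \<bar>ln r\<bar>)"
        using lim by (simp add: continuous_within)
      then show "continuous (at (norm (1 + exp w)) within (\<lambda>v. norm (1 + exp v)) ` strip) (\<lambda>r::real. inverse \<bar>ln r\<bar>)"
        using True by (auto intro: continuous_within_subset)
    qed
    then have t0: "((\<lambda>v. inverse \<bar>ln (norm (1 + exp v))\<bar>) \<longlongrightarrow> 0) (at w within strip)"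
      using True by (simp add: continuous_within o_def)
    \<comment> \<open>For modulus strictly between 0 and 1 the real logarithm is nonzero, so the
      lower bound on \<open>strip_Ln\<close> can be inverted; at modulus 1 the convention
      \<open>inverse 0 = 0\<close> would break the comparison.\<close>
    have "eventually (\<lambda>v. norm (1 + exp v) < 1) (at w within strip)"
      using c True by (auto simp: continuous_within dest: order_tendstoD(2)[where a=1])
    then have "eventually (\<lambda>v. norm (inverse (strip_Ln v)) \<le> inverse \<bar>ln (norm (1 + exp v))\<bar>) (at w within strip)"
    proof eventually_elim
      case (elim v)
      show ?case
      proof (cases "1 + exp v = 0")
        case False
        then have "ln (norm (1 + exp v)) < 0" using elim by (subst ln_less_zero_iff) auto
        then show ?thesis
          using abs_ln_le_norm_strip_Ln[of v] using le_imp_inverse_le[of "\<bar>ln (norm (1 + exp v))\<bar>" "norm (strip_Ln v)"]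
            by (simp add: norm_inverse)
      qed (simp add: strip_Ln_def)
    qed
    then have "((\<lambda>v. inverse (strip_Ln v)) \<longlongrightarrow> 0) (at w within strip)"
      using t0 by (rule Lim_null_comparison)
    then show ?thesis using True by (simp add: continuous_within strip_Ln_def)
  qed
qed

lemma continuous_on_G_strip: "continuous_on strip G_strip"
  unfolding G_strip_def divide_inverse
  by (intro continuous_intros continuous_on_inverse_strip_Ln)

lemma G_strip_eq:
  assumes "\<bar>Im w\<bar> < pi"
  shows "G_strip w = G (exp w)"
proof -
  have "Ln (exp w) = w" using assms by (intro Ln_exp) auto
  then show ?thesis using strip_Ln_eq[OF assms] by (simp add: G_strip_def G_def mult_ac)
qed

lemma holomorphic_on_G_strip: "G_strip holomorphic_on {w. \<bar>Im w\<bar> < pi}"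
proof -
  have cut: "1 + exp w \<notin> \<real>\<^sub>\<le>\<^sub>0" if "\<bar>Im w\<bar> < pi" for w :: complex
    by (rule one_plus_notin_nonpos_Reals[OF exp_notin_nonpos_Reals[OF that]])
  have nz: "Ln (1 + exp w) \<noteq> 0" if "\<bar>Im w\<bar> < pi" for w
  proof -
    have "1 + exp w \<noteq> 0" using cut[OF that] by auto
    then show ?thesis using strip_Ln_eq[OF that] strip_Ln_nonzero[of w] by simp
  qed
  have "(\<lambda>w. Ln (1 + exp w)) holomorphic_on {w. \<bar>Im w\<bar> < pi}"
    by (rule holomorphic_on_Ln') (auto intro!: holomorphic_intros dest: cut)
  then have "(\<lambda>w. (1 - w / Ln (1 + exp w)) * exp w * w) holomorphic_on {w. \<bar>Im w\<bar> < pi}"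
    using nz by (intro holomorphic_on_mult holomorphic_on_diff holomorphic_on_divide holomorphic_on_const
        holomorphic_on_ident holomorphic_on_exp') auto
  then show ?thesis
    by (rule holomorphic_transform) (simp add: G_strip_def strip_Ln_eq)
qed

section \<open>The Cauchy integrand and its limits at the two ends of the strip\<close>

text \<open>The form \<open>G \<zeta> / (\<zeta> - z) d\<zeta>\<close> pulled back along \<open>\<zeta> = exp w\<close>.\<close>
definition cauchy_integrand :: "complex \<Rightarrow> complex \<Rightarrow> complex" where
  "cauchy_integrand z w = G_strip w * exp w / (exp w - z)"

text \<open>This is the difference quotient of \<open>Ln (1 + u)\<close> at 0.\<close>

lemma tendsto_Ln_one_plus_div: "((\<lambda>u::complex. Ln (1 + u) / u) \<longlongrightarrow> 1) (at 0)"
proof -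
  have "((\<lambda>u. Ln (1 + u)) has_field_derivative 1) (at (0::complex))"
    by (auto intro!: derivative_eq_intros)
  then show ?thesis by (simp add: DERIV_def)
qed

text \<open>With l = \<open>Ln (1 + exp (-w))\<close>, the factor 1 - w / (w + l) equals l / (w +
  l), hence \<open>G_strip w\<close> = (l / exp (-w)) / (1 + l / w). The numerator tends to 1 and
  both l and 1 / w tend to 0. The estimates involve \<open>Re w\<close> only, so the limit is
  uniform in \<open>Im w\<close>.\<close>

lemma tendsto_cauchy_integrand_right:
  "(cauchy_integrand z \<longlongrightarrow> 1) (filtercomap Re at_top)"
proof -
  let ?F = "filtercomap Re at_top"
  have comp: "((\<lambda>w. f (Re w)) \<longlongrightarrow> c) ?F" if "(f \<longlongrightarrow> c) at_top" for f :: "real \<Rightarrow> real" and c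
    using that by (rule filterlim_compose[OF _ filterlim_filtercomap])
  have pos: "eventually (\<lambda>w. Re w > 0) ?F"
    using eventually_filtercomapI[OF eventually_gt_at_top[of 0], of Re] .
  have "((\<lambda>x::real. exp (-x)) \<longlongrightarrow> 0) at_top" by real_asymp
  then have v: "((\<lambda>w. exp (-w)) \<longlongrightarrow> 0) ?F"
    using comp by (intro tendsto_norm_zero_cancel[of "\<lambda>w. exp (-w)"]) simp
  then have "filterlim (\<lambda>w. exp (-w)) (at 0) ?F"
    by (intro filterlim_atI) auto
  then have lv: "((\<lambda>w. Ln (1 + exp (-w)) / exp (-w)) \<longlongrightarrow> 1) ?F"
    by (rule filterlim_compose[OF tendsto_Ln_one_plus_div])
  have l: "((\<lambda>w. Ln (1 + exp (-w))) \<longlongrightarrow> 0) ?F"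
    using tendsto_mult[OF lv v] by simp
  have inv: "((\<lambda>w. inverse w) \<longlongrightarrow> 0) ?F"
  proof (rule Lim_null_comparison)
    show "eventually (\<lambda>w. norm (inverse w) \<le> inverse (Re w)) ?F"
      using pos
    proof eventually_elim
      case (elim w)
      then show ?case using complex_Re_le_cmod[of w] by (auto simp: norm_inverse intro: le_imp_inverse_le)
    qed
    have "((\<lambda>x::real. inverse x) \<longlongrightarrow> 0) at_top" by real_asymp
    then show "((\<lambda>w. inverse (Re w)) \<longlongrightarrow> 0) ?F" by (rule comp)
  qed
  have "((\<lambda>w. Ln (1 + exp (-w)) / exp (-w) * inverse (1 + Ln (1 + exp (-w)) * inverse w)
      * inverse (1 - z * exp (-w))) \<longlongrightarrow> 1 * inverse (1 + 0 * 0) * inverse (1 - z * 0)) ?F"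
    by (intro tendsto_intros lv l inv v) simp_all
  moreover have "eventually (\<lambda>w. Ln (1 + exp (-w)) / exp (-w) * inverse (1 + Ln (1 + exp (-w)) * inverse w)
      * inverse (1 - z * exp (-w)) = cauchy_integrand z w) ?F"
    using pos
  proof eventually_elim
    case (elim w)
    have "exp w \<noteq> -1"
    proof
      assume "exp w = -1"
      then have "norm (exp w) = 1" by simp
      then show False using elim by simp
    qed
    then have ne: "1 + exp w \<noteq> 0" by (metis add.inverse_unique)
    define l where "l = Ln (1 + exp (-w))"
    have L: "strip_Ln w = w + l" using elim ne by (simp add: strip_Ln_def l_def)
    have "w \<noteq> 0" using elim by auto
    have "w + l \<noteq> 0" using strip_Ln_nonzero[OF ne] L by simp
    have "G_strip w = l / exp (-w) * inverse (1 + l * inverse w)"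
      using \<open>w \<noteq> 0\<close> \<open>w + l \<noteq> 0\<close> by (simp add: G_strip_def L exp_minus field_simps)
    moreover have "exp w / (exp w - z) = inverse (1 - z * exp (-w))"
      by (simp add: exp_minus divide_simps)
    ultimately show ?case unfolding cauchy_integrand_def l_def[symmetric] by (metis times_divide_eq_right)
  qed
  ultimately show ?thesis by (auto dest: Lim_transform_eventually)
qed

text \<open>Expanding the product leaves powers of w times \<open>exp w\<close> and the bounded
  factor \<open>exp w / Ln (1 + exp w)\<close>, over a denominator tending to -z. Inside the strip,
  |w| exceeds |Re w| by at most pi, so the exponential wins uniformly.\<close>

lemma tendsto_cauchy_integrand_left:
  assumes "z \<noteq> 0"
  shows "(cauchy_integrand z \<longlongrightarrow> 0) (inf (filtercomap Re at_bot) (principal strip))"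
proof -
  let ?F = "inf (filtercomap Re at_bot) (principal strip)"
  have comp: "((\<lambda>w. f (Re w)) \<longlongrightarrow> c) ?F" if "(f \<longlongrightarrow> c) at_bot" for f :: "real \<Rightarrow> real" and c
    using tendsto_mono[OF inf_le1 filterlim_compose[OF that filterlim_filtercomap]] .
  have neg: "eventually (\<lambda>w. Re w < 0) ?F"
    using filter_leD[OF inf_le1 eventually_filtercomapI[OF eventually_gt_at_bot[of 0], of Re]] .
  have ev: "eventually (\<lambda>w. norm w \<le> \<bar>Re w\<bar> + pi) ?F"
    unfolding eventually_inf_principal
    by (intro always_eventually allI impI) (auto simp: strip_def intro: order_trans[OF cmod_le])
  have "((\<lambda>x::real. exp x) \<longlongrightarrow> 0) at_bot" by real_asymp
  then have u: "(exp \<longlongrightarrow> (0::complex)) ?F"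
    using comp by (intro tendsto_norm_zero_cancel[of exp]) simp
  then have at: "filterlim exp (at (0::complex)) ?F"
    by (intro filterlim_atI) auto
  have "((\<lambda>w. inverse (Ln (1 + exp w) / exp w)) \<longlongrightarrow> inverse 1) ?F"
    by (intro tendsto_inverse filterlim_compose[OF tendsto_Ln_one_plus_div at]) simp
  then have ul: "((\<lambda>w. exp w / Ln (1 + exp w)) \<longlongrightarrow> 1) ?F" by simp
  have wu: "((\<lambda>w. w * exp w) \<longlongrightarrow> 0) ?F"
  proof (rule Lim_null_comparison)
    show "eventually (\<lambda>w. norm (w * exp w) \<le> (\<bar>Re w\<bar> + pi) * exp (Re w)) ?F"
      using ev by eventually_elim (simp add: norm_mult)
    have "((\<lambda>x::real. (\<bar>x\<bar> + pi) * exp x) \<longlongrightarrow> 0) at_bot" by real_asymp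
    then show "((\<lambda>w. (\<bar>Re w\<bar> + pi) * exp (Re w)) \<longlongrightarrow> 0) ?F" by (rule comp)
  qed
  have wwu: "((\<lambda>w. w * w * exp w) \<longlongrightarrow> 0) ?F"
  proof (rule Lim_null_comparison)
    show "eventually (\<lambda>w. norm (w * w * exp w) \<le> (\<bar>Re w\<bar> + pi) * (\<bar>Re w\<bar> + pi) * exp (Re w)) ?F"
      using ev by eventually_elim (simp add: norm_mult mult_mono)
    have "((\<lambda>x::real. (\<bar>x\<bar> + pi) * (\<bar>x\<bar> + pi) * exp x) \<longlongrightarrow> 0) at_bot" by real_asymp
    then show "((\<lambda>w. (\<bar>Re w\<bar> + pi) * (\<bar>Re w\<bar> + pi) * exp (Re w)) \<longlongrightarrow> 0) ?F" by (rule comp)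
  qed
  have "((\<lambda>w. (w * exp w * exp w - w * w * exp w * (exp w / Ln (1 + exp w))) * inverse (exp w - z))
      \<longlongrightarrow> (0 * 0 - 0 * 1) * inverse (0 - z)) ?F"
    using assms by (intro tendsto_intros u wu wwu ul) simp_all
  moreover have "eventually (\<lambda>w. (w * exp w * exp w - w * w * exp w * (exp w / Ln (1 + exp w))) * inverse (exp w - z)
      = cauchy_integrand z w) ?F"
    using neg
  proof eventually_elim
    case (elim w)
    have "exp w \<noteq> -1"
    proof
      assume "exp w = -1"
      then have "norm (exp w) = 1" by simp
      then show False using elim by simp
    qed
    then have "1 + exp w \<noteq> 0" by (metis add.inverse_unique)
    then have "strip_Ln w = Ln (1 + exp w)" using elim by (simp add: strip_Ln_def)
    then show ?case by (simp add: cauchy_integrand_def G_strip_def divide_inverse algebra_simps)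
  qed
  ultimately show ?thesis by (auto dest: Lim_transform_eventually)
qed

text \<open>The edges have fixed length 2 * pi, so it is enough that the integrand converges
  uniformly along them.\<close>

lemma tendsto_contour_integral_vertical:
  assumes lim: "(f \<longlongrightarrow> c) (inf (filtercomap Re F) (principal strip))"
    and int: "eventually (\<lambda>x. f contour_integrable_on linepath (Complex x (-pi)) (Complex x pi)) F"
  shows "((\<lambda>x. contour_integral (linepath (Complex x (-pi)) (Complex x pi)) f) \<longlongrightarrow> 2 * pi * \<i> * c) F"
proof (rule tendstoI)
  fix e :: real assume e: "e > 0"
  \<comment> \<open>The length 2 * pi turns this into the bound e / 2, which leaves room for the
    strict inequality.\<close>
  define d where "d = e / (4 * pi)"
  have d: "d > 0" using e by (simp add: d_def)
  have "eventually (\<lambda>w. w \<in> strip \<longrightarrow> dist (f w) c < d) (filtercomap Re F)"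
    using tendstoD[OF lim d] by (simp add: eventually_inf_principal)
  \<comment> \<open>A predicate on \<open>Re w\<close> alone holds along a whole vertical edge at
    once; this is the uniformity in \<open>Im w\<close>.\<close>
  then obtain P where P: "eventually P F" "\<And>w. P (Re w) \<Longrightarrow> w \<in> strip \<Longrightarrow> dist (f w) c < d"
    unfolding eventually_filtercomap by blast
  show "eventually (\<lambda>x. dist (contour_integral (linepath (Complex x (-pi)) (Complex x pi)) f) (2 * pi * \<i> * c) < e) F"
    using P(1) int
  proof eventually_elim
    case (elim x)
    let ?g = "linepath (Complex x (-pi)) (Complex x pi)"
    have diff: "Complex x pi - Complex x (-pi) = 2 * pi * \<i>" by (simp add: complex_eq_iff)
    have "((\<lambda>w. f w - c) has_contour_integral (contour_integral ?g f - c * (Complex x pi - Complex x (-pi)))) ?g"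
      by (intro has_contour_integral_diff has_contour_integral_integral elim(2) has_contour_integral_const_linepath)
    then have "norm (contour_integral ?g f - c * (Complex x pi - Complex x (-pi))) \<le> d * norm (Complex x pi - Complex x (-pi))"
    proof (rule has_contour_integral_bound_linepath)
      fix w assume "w \<in> closed_segment (Complex x (-pi)) (Complex x pi)"
      then have "Re w = x" "w \<in> strip"
        by (auto simp: closed_segment_same_Re strip_def closed_segment_eq_real_ivl split: if_splits)
      then show "norm (f w - c) \<le> d" using P(2)[of w] elim(1) by (simp add: dist_norm)
    qed (use d in simp)
    also have "\<dots> = e / 2" unfolding diff d_def by (simp add: norm_mult)
    finally show ?case unfolding diff using e by (simp add: dist_norm mult_ac)
  qed
qed

section \<open>Cauchy's formula on the rectangle\<close>

text \<open>In the closed strip, \<open>exp w - exp w0\<close> has a single zero, a simple one at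
  \<open>w0\<close>. Dividing out \<open>w - w0\<close> leaves an entire function d without zeros
  there, so the integrand is a Cauchy kernel at \<open>w0\<close> times a function f that is regular
  in the strip.\<close>

lemma has_contour_integral_cauchy_integrand:
  assumes w0: "\<bar>Im w0\<bar> < pi" and r: "\<bar>Re w0\<bar> < r"
  shows "(cauchy_integrand (exp w0) has_contour_integral 2 * pi * \<i> * G_strip w0)
           (rectpath (Complex (-r) (-pi)) (Complex r pi))"
proof -
  let ?a = "Complex (-r) (-pi)" and ?b = "Complex r pi"
  \<comment> \<open>The value at \<open>w0\<close> is the derivative of \<open>exp\<close>, which
    removes the singularity and cancels \<open>exp w0\<close> in f, so that f takes the value
    \<open>G_strip w0\<close> at \<open>w0\<close>.\<close>
  define d where "d w = (if w = w0 then exp w0 else (exp w - exp w0) / (w - w0))" for w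
  define f where "f w = G_strip w * exp w / d w" for w
  have "(\<lambda>w. if w = w0 then deriv exp w0 else (exp w - exp w0) / (w - w0)) holomorphic_on UNIV"
    by (rule pole_lemma_open) (auto intro: holomorphic_intros)
  moreover have "deriv exp w0 = exp w0" by (intro DERIV_imp_deriv DERIV_exp)
  ultimately have hold: "d holomorphic_on UNIV" by (simp add: d_def[abs_def] cong: if_cong)
  have d_nz: "d w \<noteq> 0" if "w \<in> strip" for w
  proof -
    \<comment> \<open>The inequality is strict because \<open>w0\<close> lies in the open strip;
      hence no other point of the closed strip has the same exponential.\<close>
    have "\<bar>Im w - Im w0\<bar> < 2 * pi" using that w0 by (simp add: strip_def)
    then have "exp w = exp w0 \<Longrightarrow> w = w0" using exp_complex_eqI by blast
    then show ?thesis by (auto simp: d_def)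
  qed
  have sub: "cbox ?a ?b \<subseteq> strip" by (auto simp: in_cbox_complex_iff strip_def)
  have w0_box: "w0 \<in> box ?a ?b" using assms by (auto simp: in_box_complex_iff)
  have le: "Re ?a \<le> Re ?b" "Im ?a \<le> Im ?b" using r by auto
  have path: "path_image (rectpath ?a ?b) \<subseteq> cbox ?a ?b - {w0}"
    using path_image_rectpath_subset_cbox[OF le] path_image_rectpath_inter_box[OF le] w0_box by auto
  have "((\<lambda>w. f w / (w - w0)) has_contour_integral
      (2 * pi * \<i> * winding_number (rectpath ?a ?b) w0 * f w0)) (rectpath ?a ?b)"
  \<comment> \<open>This form asks for differentiability in the interior only, and on the edges
    \<open>G_strip\<close> is known to be continuous, not holomorphic.\<close>
  proof (rule Cauchy_integral_formula_weak[where S = "cbox ?a ?b" and k = "{}"])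
    show "continuous_on (cbox ?a ?b) f"
      unfolding f_def using sub d_nz
      by (intro continuous_intros continuous_on_subset[OF continuous_on_G_strip]
            holomorphic_on_imp_continuous_on holomorphic_on_subset[OF hold]) auto
    show "f field_differentiable at w" if "w \<in> interior (cbox ?a ?b) - {}" for w
    proof -
      have w: "w \<in> {w. \<bar>Im w\<bar> < pi}"
        using that by (auto simp: interior_cbox in_box_complex_iff)
      have op: "open {w. \<bar>Im w\<bar> < pi}"
        by (intro open_Collect_less continuous_intros)
      have "f holomorphic_on {w. \<bar>Im w\<bar> < pi}"
        unfolding f_def using d_nz
        by (intro holomorphic_intros holomorphic_on_G_strip holomorphic_on_subset[OF hold])
           (auto simp: strip_def)
      then show ?thesis using op w by (simp add: holomorphic_on_open field_differentiable_def)
    qed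
  qed (use w0_box path in \<open>auto simp: interior_cbox\<close>)
  then have "((\<lambda>w. f w / (w - w0)) has_contour_integral 2 * pi * \<i> * G_strip w0) (rectpath ?a ?b)"
    by (simp add: winding_number_rectpath[OF w0_box] f_def d_def)
  then show ?thesis
  proof (rule has_contour_integral_eq)
    fix w assume "w \<in> path_image (rectpath ?a ?b)"
    then have "w \<noteq> w0" using path by auto
    then show "f w / (w - w0) = cauchy_integrand (exp w0) w"
      by (simp add: f_def d_def cauchy_integrand_def)
  qed
qed

section \<open>Horizontal edges, conjugation symmetry and the boundary density\<close>

lemma has_contour_integral_linepath_same_Im_iff:
  assumes "a < b"
  shows "(f has_contour_integral I) (linepath (Complex a c) (Complex b c)) \<longleftrightarrow>
    ((\<lambda>x. f (Complex x c)) has_integral I) {a..b}"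
proof -
  have "linepath (Complex a c) (Complex b c) x = linepath (of_real a) (of_real b) x + \<i> * c" for x
    by (simp add: linepath_def complex_eq_iff algebra_simps)
  moreover have "Complex b c - Complex a c = of_real b - of_real a"
    by (simp add: complex_eq_iff)
  ultimately have "(f has_contour_integral I) (linepath (Complex a c) (Complex b c)) \<longleftrightarrow>
    ((\<lambda>w. f (w + \<i> * c)) has_contour_integral I) (linepath (of_real a) (of_real b))"
    by (simp add: has_contour_integral_linepath)
  also have "\<dots> \<longleftrightarrow> ((\<lambda>x. f (of_real x + \<i> * c)) has_integral I) {a..b}"
    using assms by (subst has_contour_integral_linepath_Reals_iff) auto
  finally show ?thesis by (simp add: Complex_eq)
qed

lemma strip_Ln_cnj: "strip_Ln (cnj w) = cnj (strip_Ln w)"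
proof -
  have "1 + exp (cnj w) = cnj (1 + exp w)" "1 + exp (- cnj w) = cnj (1 + exp (-w))"
    by (simp_all add: exp_cnj)
  moreover have "1 + exp w \<noteq> 0 \<Longrightarrow> Re w \<le> 0 \<Longrightarrow> Ln (cnj (1 + exp w)) = cnj (Ln (1 + exp w))"
    using cnj_Ln[OF one_plus_exp_notin_nonpos_Reals(1)] by metis
  moreover have "1 + exp w \<noteq> 0 \<Longrightarrow> Re w \<ge> 0 \<Longrightarrow> Ln (cnj (1 + exp (-w))) = cnj (Ln (1 + exp (-w)))"
    using cnj_Ln[OF one_plus_exp_notin_nonpos_Reals(2)] by metis
  ultimately show ?thesis
    unfolding strip_Ln_def by (simp del: complex_cnj_add add: complex_cnj_zero_iff) (simp add: complex_cnj_add)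
qed

lemma G_strip_cnj: "G_strip (cnj w) = cnj (G_strip w)"
  by (simp add: G_strip_def strip_Ln_cnj exp_cnj)

text \<open>The density read off as the boundary value of \<open>G\<close> from above the cut. Unlike \<open>\<rho>\<close>,
  it is continuous at \<open>t = 1\<close>, where it equals \<open>-1\<close>.\<close>
definition \<rho>_strip :: "real \<Rightarrow> real" where
  "\<rho>_strip t = Im (G_strip (Complex (ln t) pi)) / pi"

lemma exp_Complex_ln_pi:
  assumes "t > 0"
  shows "exp (Complex (ln t) pi) = - of_real t" "exp (- Complex (ln t) pi) = - of_real (1 / t)"
  using assms by (auto simp: complex_eq_iff Re_exp Im_exp exp_minus[where 'a = real] inverse_eq_divide)

text \<open>Put w = ln t + i pi, so \<open>exp w\<close> = -t. For t < 1 the logarithm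
  \<open>strip_Ln w\<close> is the real number L = ln (1 - t), and w - w^2 / L has imaginary part pi
  (1 - 2 ln t / L). For t > 1 it is M + i pi with M = ln (t - 1), so 1 - w / (M + i pi) = (M - ln t)
  / (M + i pi), and a second factor M - ln t comes from the imaginary part of w / (M + i
  pi).\<close>

lemma \<rho>_strip_eq:
  assumes "t > 0" "t \<noteq> 1"
  shows "\<rho>_strip t = \<rho> t"
proof (cases "t < 1")
  case True
  define l L where "l = ln t" and "L = ln (1 - t)"
  have L: "L \<noteq> 0" using True assms by (simp add: L_def)
  have one: "1 + exp (Complex l pi) = of_real (1 - t)"
    using assms by (simp add: exp_Complex_ln_pi l_def)
  have "l \<le> 0" using assms True by (simp add: l_def)
  then have "strip_Ln (Complex l pi) = of_real L"
    unfolding strip_Ln_def one using True assms by (simp add: L_def Ln_of_real del: of_real_diff)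
  then have "G_strip (Complex l pi) = (1 - Complex l pi / of_real L) * (- of_real t) * Complex l pi"
    using assms by (simp add: G_strip_def exp_Complex_ln_pi l_def)
  also have "\<dots> = of_real (- t) * (Complex l pi - Complex l pi * Complex l pi / of_real L)"
    by (simp add: algebra_simps)
  finally have "Im (G_strip (Complex l pi)) = - t * Im (Complex l pi - Complex l pi * Complex l pi / of_real L)"
    by (simp only: times_complex.sel Re_complex_of_real Im_complex_of_real mult_zero_left add_0_right)
  also have "Im (Complex l pi - Complex l pi * Complex l pi / of_real L) = pi * (1 - 2 * l / L)"
    by (simp add: algebra_simps add_divide_distrib)
  finally have "\<rho>_strip t = - t * (1 - 2 * l / L)"
    by (simp add: \<rho>_strip_def l_def[symmetric])
  moreover have "ln ((1 - t) / t\<^sup>2) = L - 2 * l"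
    using True assms by (simp add: ln_div L_def l_def ln_realpow)
  ultimately have "\<rho> t = - (t * (L - 2 * l) / L)"
    using True assms by (simp add: \<rho>_def L_def[symmetric])
  also have "\<dots> = - t * (1 - 2 * l / L)" using L by (simp add: field_simps)
  finally show ?thesis using \<open>\<rho>_strip t = - t * (1 - 2 * l / L)\<close> by simp
next
  case False
  then have t: "t > 1" using assms by simp
  define l M where "l = ln t" and "M = ln (t - 1)"
  have one: "1 + exp (- Complex l pi) = of_real (1 - 1 / t)"
    using assms by (simp add: exp_Complex_ln_pi l_def)
  have ne: "1 + exp (Complex l pi) \<noteq> 0"
    using t assms by (simp add: exp_Complex_ln_pi l_def)
  have lM: "ln ((t - 1) / t) = M - l" using t by (simp add: M_def l_def ln_div)
  have "1 - 1 / t = (t - 1) / t" using t by (simp add: field_simps)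
  then have "Ln (of_real (1 - 1 / t)) = of_real (M - l)"
    using lM t by (simp add: Ln_of_real del: of_real_diff of_real_divide)
  moreover have "l > 0" using t by (simp add: l_def)
  ultimately have "strip_Ln (Complex l pi) = Complex l pi + of_real (M - l)"
    unfolding strip_Ln_def one using ne by simp
  then have SL: "strip_Ln (Complex l pi) = Complex M pi"
    by (simp add: complex_eq_iff)
  have nz: "M\<^sup>2 + pi\<^sup>2 > 0" by (simp add: add_nonneg_pos)
  have "Complex M pi \<noteq> 0" by (simp add: complex_eq_iff)
  then have "1 - Complex l pi / Complex M pi = of_real (M - l) / Complex M pi"
    by (simp add: divide_simps Complex_eq)
  then have "G_strip (Complex l pi) = of_real (M - l) / Complex M pi * (- of_real t) * Complex l pi"
    using assms SL by (simp add: G_strip_def exp_Complex_ln_pi l_def)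
  also have "\<dots> = of_real (- t * (M - l)) * (Complex l pi / Complex M pi)" by simp
  finally have "Im (G_strip (Complex l pi)) = - t * (M - l) * Im (Complex l pi / Complex M pi)"
    by (simp only: times_complex.sel Re_complex_of_real Im_complex_of_real mult_zero_left add_0_right)
  also have "Im (Complex l pi / Complex M pi) = pi * (M - l) / (M\<^sup>2 + pi\<^sup>2)"
    by (simp add: Im_divide algebra_simps)
  finally have "\<rho>_strip t = - (t * (M - l)\<^sup>2 / (M\<^sup>2 + pi\<^sup>2))"
    by (simp add: \<rho>_strip_def l_def[symmetric] power2_eq_square)
  then show ?thesis using t lM by (simp add: \<rho>_def M_def[symmetric])
qed

lemma continuous_on_\<rho>_strip: "continuous_on {0<..} \<rho>_strip"
proof -
  have "continuous_on {0<..} (\<lambda>t. G_strip (of_real (ln t) + \<i> * pi))"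
    by (rule continuous_on_compose2[OF continuous_on_G_strip])
       (auto intro!: continuous_intros simp: strip_def)
  then show ?thesis
    unfolding \<rho>_strip_def Complex_eq by (intro continuous_intros) auto
qed

section \<open>From the contour identity to truncated integrals of the kernel\<close>

lemma continuous_on_cauchy_integrand:
  assumes "\<bar>Im w0\<bar> < pi"
  shows "continuous_on (strip - {w0}) (cauchy_integrand (exp w0))"
proof -
  have "exp w \<noteq> exp w0" if "w \<in> strip - {w0}" for w
  proof -
    have "\<bar>Im w - Im w0\<bar> < 2 * pi" using that assms by (auto simp: strip_def)
    then show ?thesis using exp_complex_eqI that by blast
  qed
  then show ?thesis
    unfolding cauchy_integrand_def
    by (intro continuous_intros continuous_on_subset[OF continuous_on_G_strip]) auto
qed

lemma add_of_real_nonzero: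
  fixes z :: complex
  assumes "z \<notin> \<real>\<^sub>\<le>\<^sub>0" "t \<ge> 0"
  shows "z + complex_of_real t \<noteq> 0"
  using assms by (auto simp: complex_nonpos_Reals_iff complex_eq_iff)

lemma continuous_on_kernel:
  assumes "z \<notin> \<real>\<^sub>\<le>\<^sub>0"
  shows "continuous_on {0<..} (\<lambda>t. complex_of_real (\<rho>_strip t) / (z + of_real t))"
  using add_of_real_nonzero[OF assms]
  by (intro continuous_intros continuous_on_\<rho>_strip) auto

text \<open>Cauchy's formula is split into the four edges. The bottom and top edges combine, by
  conjugation symmetry, into -2 pi i times the kernel integral; the vertical edges remain as
  \<open>V\<close>.\<close>

lemma integral_kernel_eq:
  assumes w0: "\<bar>Im w0\<bar> < pi" and r: "\<bar>Re w0\<bar> < r"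
  defines "z \<equiv> exp w0"
  defines "V \<equiv> \<lambda>x. contour_integral (linepath (Complex x (-pi)) (Complex x pi)) (cauchy_integrand z)"
  shows "integral {exp (-r)..exp r} (\<lambda>t. complex_of_real (\<rho>_strip t) / (z + of_real t))
    = (V r - V (-r)) / (2 * pi * \<i>) - G_strip w0"
proof -
  let ?H = "cauchy_integrand z"
  let ?a = "Complex (-r) (-pi)" and ?b = "Complex r (-pi)" and ?c = "Complex r pi" and ?d = "Complex (-r) pi"
  define J where "J = integral {exp (-r)..exp r} (\<lambda>t. complex_of_real (\<rho>_strip t) / (z + of_real t))"
  have z: "z \<notin> \<real>\<^sub>\<le>\<^sub>0" unfolding z_def by (rule exp_notin_nonpos_Reals[OF w0])
  have int: "?H contour_integrable_on linepath p q"
    if "closed_segment p q \<subseteq> strip - {w0}" for p q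
    unfolding z_def using that
    by (intro contour_integrable_continuous_linepath continuous_on_subset[OF continuous_on_cauchy_integrand[OF w0]])
  have vert: "closed_segment (Complex x (-pi)) (Complex x pi) \<subseteq> strip - {w0}" if "x \<noteq> Re w0" for x
    using that by (auto simp: closed_segment_same_Re strip_def closed_segment_eq_real_ivl)
  have horiz: "closed_segment (Complex (-r) y) (Complex r y) \<subseteq> strip - {w0}" if "\<bar>y\<bar> = pi" for y
    using that w0 by (auto simp: closed_segment_same_Im strip_def)
  have i1: "?H contour_integrable_on linepath ?a ?b" by (rule int[OF horiz]) simp
  have i2: "?H contour_integrable_on linepath ?b ?c" by (rule int[OF vert]) (use r in auto)
  have i3: "?H contour_integrable_on linepath ?c ?d"
    by (rule int) (subst closed_segment_commute, rule horiz, simp)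
  have i4: "?H contour_integrable_on linepath ?d ?a"
    by (rule int) (subst closed_segment_commute, rule vert, use r in auto)
  define B T where "B = contour_integral (linepath ?a ?b) ?H"
    and "T = contour_integral (linepath ?d ?c) ?H"
  have rev: "contour_integral (linepath ?c ?d) ?H = - T"
    "contour_integral (linepath ?d ?a) ?H = - V (-r)"
    unfolding T_def V_def
    using contour_integral_reversepath[of "linepath ?d ?c" ?H] contour_integral_reversepath[of "linepath ?a ?d" ?H]
    by simp_all
  have "contour_integral (rectpath ?a ?c) ?H = B + (V r + (- T + - V (-r)))"
    using i1 i2 i3 i4 by (simp add: rectpath_def Let_def rev) (simp add: B_def V_def)
  moreover have "contour_integral (rectpath ?a ?c) ?H = 2 * pi * \<i> * G_strip w0"
    unfolding z_def by (rule contour_integral_unique[OF has_contour_integral_cauchy_integrand[OF w0 r]])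
  ultimately have total: "B - T = 2 * pi * \<i> * G_strip w0 - V r + V (-r)"
    by (simp add: algebra_simps)
  have rr: "-r < r" using r by simp
  have hB: "((\<lambda>x. ?H (Complex x (-pi))) has_integral B) {-r..r}"
    using has_contour_integral_integral[OF i1] has_contour_integral_linepath_same_Im_iff[OF rr]
    unfolding B_def by blast
  have hT: "((\<lambda>x. ?H (Complex x pi)) has_integral T) {-r..r}"
    using has_contour_integral_integral[OF int[OF horiz[of pi]]] has_contour_integral_linepath_same_Im_iff[OF rr]
    unfolding T_def by force
  \<comment> \<open>The substitution t = exp x carries the edge coordinate to the cut; its Jacobian
    is, up to sign, the factor \<open>exp w\<close> of the Cauchy integrand.\<close>
  have "((\<lambda>x. exp x *\<^sub>R (of_real (\<rho>_strip (exp x)) / (z + of_real (exp x)))) has_integral J) {-r..r}"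
    unfolding J_def
  proof (rule has_integral_substitution)
    show "continuous_on {exp (- r)..exp r} (\<lambda>t. complex_of_real (\<rho>_strip t) / (z + of_real t))"
      by (rule continuous_on_subset[OF continuous_on_kernel[OF z]]) (auto intro: less_le_trans[OF exp_gt_zero])
  qed (use rr in \<open>auto intro!: derivative_eq_intros\<close>)
  then have "((\<lambda>x. - 2 * pi * \<i> * (exp x *\<^sub>R (of_real (\<rho>_strip (exp x)) / (z + of_real (exp x)))))
      has_integral - 2 * pi * \<i> * J) {-r..r}"
    by (rule has_integral_mult_right)
  moreover have "- 2 * pi * \<i> * (exp x *\<^sub>R (of_real (\<rho>_strip (exp x)) / (z + of_real (exp x))))
      = ?H (Complex x (-pi)) - ?H (Complex x pi)" for x
  proof -
    define g where "g = G_strip (Complex x pi)"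
    have e: "exp (Complex x pi) = - of_real (exp x)" "exp (Complex x (-pi)) = - of_real (exp x)"
      by (simp_all add: complex_eq_iff Re_exp Im_exp)
    have "Complex x (-pi) = cnj (Complex x pi)" by (simp add: complex_eq_iff)
    then have c: "G_strip (Complex x (-pi)) = cnj g" unfolding g_def by (metis G_strip_cnj)
    \<comment> \<open>On both edges \<open>exp w\<close> = -t, and the signs of numerator and
      denominator cancel.\<close>
    have k: "- of_real (exp x) / (- of_real (exp x) - z) = of_real (exp x) / (z + of_real (exp x))"
      using minus_divide_divide[of "of_real (exp x)" "of_real (exp x) + z"]
      by (simp add: add.commute[of z])
    have "?H (Complex x (-pi)) - ?H (Complex x pi) = (cnj g - g) * (of_real (exp x) / (z + of_real (exp x)))"
      unfolding cauchy_integrand_def c e k[symmetric] g_def[symmetric] by (simp add: algebra_simps diff_divide_distrib)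
    also have "cnj g - g = - 2 * \<i> * of_real (Im g)" by (simp add: complex_eq_iff)
    also have "Im g = pi * \<rho>_strip (exp x)" by (simp add: \<rho>_strip_def g_def)
    finally show ?thesis by (simp add: scaleR_conv_of_real mult_ac)
  qed
  ultimately have "((\<lambda>x. ?H (Complex x (-pi)) - ?H (Complex x pi)) has_integral - 2 * pi * \<i> * J) {-r..r}"
    by simp
  with has_integral_diff[OF hB hT] have "B - T = - 2 * pi * \<i> * J"
    using has_integral_unique by blast
  with total have "2 * pi * \<i> * J = V r - V (-r) - 2 * pi * \<i> * G_strip w0" by (simp add: algebra_simps)
  then have "J = (V r - V (-r)) / (2 * pi * \<i>) - G_strip w0" by (simp add: field_simps)
  then show ?thesis unfolding J_def .
qed

text \<open>The right edge contributes 2 pi i and the left edge 0 in the limit. This is only an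
  improper integral over growing intervals; absolute integrability needs separate bounds.\<close>

lemma tendsto_integral_kernel:
  assumes w0: "\<bar>Im w0\<bar> < pi"
  shows "((\<lambda>r. integral {exp (-r)..exp r} (\<lambda>t. complex_of_real (\<rho>_strip t) / (exp w0 + of_real t)))
    \<longlongrightarrow> 1 - G_strip w0) at_top"
proof -
  define V where "V x = contour_integral (linepath (Complex x (-pi)) (Complex x pi)) (cauchy_integrand (exp w0))" for x
  have int: "cauchy_integrand (exp w0) contour_integrable_on linepath (Complex x (-pi)) (Complex x pi)"
    if "x \<noteq> Re w0" for x
    using that
    by (intro contour_integrable_continuous_linepath continuous_on_subset[OF continuous_on_cauchy_integrand[OF w0]])
       (auto simp: closed_segment_same_Re strip_def closed_segment_eq_real_ivl)
  have "(V \<longlongrightarrow> 2 * pi * \<i> * 1) at_top"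
    unfolding V_def
    by (intro tendsto_contour_integral_vertical tendsto_mono[OF inf_le1 tendsto_cauchy_integrand_right]
          eventually_mono[OF eventually_gt_at_top[of "Re w0"]] int) simp
  moreover have "(V \<longlongrightarrow> 2 * pi * \<i> * 0) at_bot"
    unfolding V_def
    by (intro tendsto_contour_integral_vertical tendsto_cauchy_integrand_left
          eventually_mono[OF eventually_gt_at_bot[of "Re w0"]] int) simp_all
  then have "((\<lambda>r. V (-r)) \<longlongrightarrow> 2 * pi * \<i> * 0) at_top"
    by (rule filterlim_compose[OF _ filterlim_uminus_at_bot_at_top])
  ultimately have "((\<lambda>r. (V r - V (-r)) / (2 * pi * \<i>) - G_strip w0)
      \<longlongrightarrow> (2 * pi * \<i> * 1 - 2 * pi * \<i> * 0) / (2 * pi * \<i>) - G_strip w0) at_top"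
    by (intro tendsto_intros) simp_all
  then have "((\<lambda>r. (V r - V (-r)) / (2 * pi * \<i>) - G_strip w0) \<longlongrightarrow> 1 - G_strip w0) at_top"
    by simp
  then show ?thesis
    by (rule Lim_transform_eventually)
       (use eventually_gt_at_top[of "\<bar>Re w0\<bar>"] in eventually_elim, simp add: integral_kernel_eq[OF w0] V_def)
qed

section \<open>Absolute integrability of the kernel\<close>

text \<open>Nonnegativity upgrades gauge integrability to Lebesgue integrability, and continuity
  supplies the Borel measurability for descending from the completed measure.\<close>

lemma set_integrable_lborel_nonneg:
  fixes f :: "real \<Rightarrow> real"
  assumes "f integrable_on S" "S \<in> sets borel" "continuous_on S f" "\<And>x. x \<in> S \<Longrightarrow> f x \<ge> 0"
  shows "set_integrable lborel S f"
proof -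
  have "set_integrable lebesgue S f"
    using assms(1,4) by (rule nonnegative_absolutely_integrable_1)
  then show ?thesis
    using borel_measurable_continuous_on_indicator[OF assms(2,3)]
    unfolding set_integrable_def by (subst (asm) integrable_completion) auto
qed

text \<open>The factor t / (-ln (1 - t)) lies in [0, 1]. What is left is at most -2 ln t = 4 ln (t
  powr (-1/2)), and ln x \<le> x - 1 trades this logarithm for an integrable power.\<close>

lemma norm_\<rho>_le_near_0:
  assumes "0 < t" "t \<le> 1/2"
  shows "\<bar>\<rho> t\<bar> \<le> 4 * t powr (-1/2)"
proof -
  define A where "A = ln ((1 - t) / t\<^sup>2)"
  have L: "ln (1 - t) \<le> - t" "ln (1 - t) < 0" using assms ln_le_minus_one[of "1 - t"] by simp_all
  have "t\<^sup>2 \<le> 1 - t"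
  proof -
    have "t * t \<le> 1/2 * (1/2)" using assms by (intro mult_mono) auto
    then show ?thesis using assms by (simp add: power2_eq_square)
  qed
  then have A0: "A \<ge> 0" using assms by (simp add: A_def)
  have "A = ln (1 - t) - 2 * ln t" using assms by (simp add: A_def ln_div ln_realpow)
  also have "\<dots> \<le> - 2 * ln t" using L by simp
  also have "\<dots> = 4 * ln (t powr (-1/2))" using assms by (simp add: ln_powr)
  also have "\<dots> \<le> 4 * t powr (-1/2)" using ln_le_minus_one[of "t powr (-1/2)"] assms by simp
  finally have A1: "A \<le> 4 * t powr (-1/2)" .
  define s where "s = t / - ln (1 - t)"
  have "0 \<le> s" "s \<le> 1"
    using L assms by (simp_all add: s_def field_simps)
  moreover have "\<rho> t = s * A" using assms by (simp add: \<rho>_def A_def s_def)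
  ultimately have "\<bar>\<rho> t\<bar> \<le> A" using A0 mult_right_mono[of s 1 A] by (simp add: abs_mult)
  then show ?thesis using A1 by simp
qed

text \<open>The logarithm of (t - 1) / t is of size at most 1 / (t - 1) \<le> 2 / t, and the
  denominator is at least pi^2 \<ge> 1.\<close>

lemma norm_\<rho>_le_at_top:
  assumes "t \<ge> 2"
  shows "\<bar>\<rho> t\<bar> \<le> 4 / t"
proof -
  define q where "q = ln ((t - 1) / t)"
  have "- q = ln (t / (t - 1))" using assms by (simp add: q_def ln_div)
  also have "\<dots> \<le> t / (t - 1) - 1" using assms by (intro ln_le_minus_one) simp
  also have "\<dots> = 1 / (t - 1)" using assms by (simp add: field_simps)
  also have "\<dots> \<le> 2 / t" using assms by (simp add: field_simps)
  finally have q1: "- q \<le> 2 / t" .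
  have "q \<le> 0" using assms by (simp add: q_def)
  then have "q\<^sup>2 \<le> (2 / t)\<^sup>2" using power_mono[OF q1, of 2] by simp
  have "1 \<le> pi" using pi_gt3 by simp
  then have "1 * 1 \<le> pi * pi" by (intro mult_mono) auto
  then have D: "(ln (t - 1))\<^sup>2 + pi\<^sup>2 \<ge> 1"
    by (intro add_increasing) (simp_all add: power2_eq_square)
  have "\<bar>\<rho> t\<bar> = t * q\<^sup>2 / ((ln (t - 1))\<^sup>2 + pi\<^sup>2)"
    using assms D by (simp add: \<rho>_def q_def)
  also have "\<dots> \<le> t * (2 / t)\<^sup>2 / 1"
    using D \<open>q\<^sup>2 \<le> (2 / t)\<^sup>2\<close> assms by (intro frac_le mult_left_mono) auto
  also have "\<dots> = 4 / t" using assms by (simp add: power2_eq_square)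
  finally show ?thesis .
qed

lemma set_integrable_kernel:
  assumes z: "z \<notin> \<real>\<^sub>\<le>\<^sub>0"
  shows "set_integrable lborel {0<..} (\<lambda>t. complex_of_real (\<rho>_strip t) / (z + of_real t))"
proof -
  let ?K = "\<lambda>t. complex_of_real (\<rho>_strip t) / (z + of_real t)"
  \<comment> \<open>Beyond T, both t \<ge> 2, as the tail bound on \<rho> requires, and |z + t|
    \<ge> t / 2 hold.\<close>
  define T where "T = 2 + 2 * norm z"
  have T: "T \<ge> 2" by (simp add: T_def)
  have meas: "set_borel_measurable lborel S ?K" if "S \<in> sets borel" "S \<subseteq> {0<..}" for S
    using borel_measurable_continuous_on_indicator[OF that(1) continuous_on_subset[OF continuous_on_kernel[OF z] that(2)]]
    by (simp add: set_borel_measurable_def)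
  have "bounded ((\<lambda>t. inverse (z + complex_of_real t)) ` {0..1/2})"
    using add_of_real_nonzero[OF z]
    by (intro compact_imp_bounded compact_continuous_image continuous_intros) auto
  then obtain C where C: "\<And>t. t \<in> {0..1/2} \<Longrightarrow> norm (inverse (z + complex_of_real t)) \<le> C"
    unfolding bounded_iff by blast
  have "set_integrable lborel {0<..1/2::real} (\<lambda>t. t powr (-1/2))"
    by (rule set_integrable_lborel_nonneg)
       (auto intro!: integrable_on_powr_from_0' continuous_intros)
  then have "set_integrable lborel {0<..1/2::real} (\<lambda>t. (4 * C) * t powr (-1/2))"
    by simp
  then have 1: "set_integrable lborel {0<..1/2} ?K"
  proof (rule set_integrable_bound)
    show "AE t in lborel. t \<in> {0<..1/2} \<longrightarrow> norm (?K t) \<le> norm ((4 * C) * t powr (-1/2))"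
    proof (intro always_eventually allI impI)
      fix t :: real assume t: "t \<in> {0<..1/2}"
      have "\<rho>_strip t = \<rho> t" using t by (intro \<rho>_strip_eq) auto
      then have "norm (?K t) = \<bar>\<rho> t\<bar> * norm (inverse (z + complex_of_real t))"
        by (simp only: divide_inverse norm_mult norm_of_real)
      also have "\<dots> \<le> (4 * t powr (-1/2)) * C"
        using t by (intro mult_mono norm_\<rho>_le_near_0 C) auto
      finally show "norm (?K t) \<le> norm ((4 * C) * t powr (-1/2))" by (simp add: mult_ac)
    qed
  qed (rule meas, auto)
  \<comment> \<open>Continuity of \<open>\<rho>_strip\<close> across t = 1 lets compactness settle
    the whole middle range.\<close>
  have 2: "set_integrable lborel {1/2..T} ?K"
    by (intro borel_integrable_atLeastAtMost' continuous_on_subset[OF continuous_on_kernel[OF z]]) auto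
  have "(\<lambda>t. t powr -2) integrable_on {T..}"
    using has_integral_powr_to_inf[of "-2" T] T by (auto simp: integrable_on_def)
  then have "set_integrable lborel {T..} (\<lambda>t. t powr -2)"
    using T by (intro set_integrable_lborel_nonneg continuous_intros) auto
  then have "set_integrable lborel {T..} (\<lambda>t. 8 * t powr -2)" by simp
  then have 3: "set_integrable lborel {T..} ?K"
  proof (rule set_integrable_bound)
    show "AE t in lborel. t \<in> {T..} \<longrightarrow> norm (?K t) \<le> norm (8 * t powr -2)"
    proof (intro always_eventually allI impI)
      fix t :: real assume "t \<in> {T..}"
      then have t: "t \<ge> 2" "t \<ge> 2 * norm z" using T norm_ge_zero[of z] by (simp_all add: T_def del: norm_ge_zero)
      have "t / 2 \<le> norm (complex_of_real t) - norm z" using t by simp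
      also have "\<dots> \<le> norm (z + complex_of_real t)"
        using norm_triangle_ineq2[of "complex_of_real t" "- z"] by (simp add: add.commute)
      finally have "norm (?K t) \<le> (4 / t) / (t / 2)"
        using t norm_\<rho>_le_at_top[of t]
        by (simp only: norm_divide norm_of_real) (intro frac_le; simp add: \<rho>_strip_eq)
      also have "\<dots> = 8 * t powr -2"
        using t by (simp add: powr_minus powr_numeral field_simps power2_eq_square)
      finally show "norm (?K t) \<le> norm (8 * t powr -2)" by simp
    qed
  qed (rule meas, use T in auto)
  have "{0<..} = {0<..1/2} \<union> {1/2..T} \<union> {T..}" using T by auto
  then show ?thesis by (simp only:) (intro set_integrable_Un 1 2 3; simp)
qed

section \<open>Passage to the Lebesgue integral and the conclusion\<close>

text \<open>The intervals [exp (-n), exp n] increase to the positive half-line, so by integrability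
  the integrals over them converge to the Lebesgue integral; uniqueness of limits identifies it with
  the contour limit.\<close>

lemma kernel_integral:
  assumes w0: "\<bar>Im w0\<bar> < pi"
  shows "(LINT t:{0<..}|lborel. complex_of_real (\<rho>_strip t) / (exp w0 + of_real t)) = 1 - G_strip w0"
proof -
  let ?K = "\<lambda>t. complex_of_real (\<rho>_strip t) / (exp w0 + of_real t)"
  define A where "A n = {exp (- real n)..exp (real n)}" for n :: nat
  have int: "set_integrable lborel {0<..} ?K"
    by (rule set_integrable_kernel[OF exp_notin_nonpos_Reals[OF w0]])
  have pos: "A n \<subseteq> {0<..}" for n
    by (auto simp: A_def intro: less_le_trans[OF exp_gt_zero])
  have "(\<Union>n. A n) = {0<..}"
  proof (rule equalityI[OF UN_least[OF pos]])
    show "{0<..} \<subseteq> (\<Union>n. A n)"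
    proof
      fix t :: real assume t: "t \<in> {0<..}"
      obtain n :: nat where "\<bar>ln t\<bar> \<le> real n" using real_arch_simple by blast
      then have n: "- real n \<le> ln t" "ln t \<le> real n" by auto
      have "exp (- real n) \<le> t" using n(1) t ln_ge_iff[of t "- real n"] by simp
      moreover have "t \<le> exp (real n)" using n(2) t by (metis exp_le_cancel_iff exp_ln greaterThan_iff)
      ultimately show "t \<in> (\<Union>n. A n)" by (auto simp: A_def)
    qed
  qed
  moreover have "(\<lambda>n. LINT t:A n|lborel. ?K t) \<longlonglongrightarrow> (LINT t:(\<Union>n. A n)|lborel. ?K t)"
    using int \<open>(\<Union>n. A n) = {0<..}\<close>
    by (intro set_integral_cont_up) (auto simp: A_def incseq_def intro: order_trans)
  moreover have "(LINT t:A n|lborel. ?K t) = integral (A n) ?K" for n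
    by (rule set_borel_integral_eq_integral(2)[OF set_integrable_subset[OF int _ pos]]) (simp add: A_def)
  ultimately have "(\<lambda>n. integral (A n) ?K) \<longlonglongrightarrow> (LINT t:{0<..}|lborel. ?K t)"
    by simp
  moreover have "(\<lambda>n. integral (A n) ?K) \<longlonglongrightarrow> 1 - G_strip w0"
    unfolding A_def
    by (rule filterlim_compose[OF tendsto_integral_kernel[OF w0] filterlim_real_sequentially])
  ultimately show ?thesis by (rule LIMSEQ_unique)
qed

theorem theorem1p1:
  fixes z :: complex
  assumes "z \<in> cut_plane"
  shows "set_integrable lborel {0<..} (\<lambda>t::real. complex_of_real (\<rho> t) / (z + complex_of_real t))
    \<and> G z = 1 - (LINT t:{0<..}|lborel. complex_of_real (\<rho> t) / (z + complex_of_real t))"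
proof -
  let ?K = "\<lambda>t::real. complex_of_real (\<rho> t) / (z + complex_of_real t)"
  let ?K' = "\<lambda>t::real. complex_of_real (\<rho>_strip t) / (z + complex_of_real t)"
  have z: "z \<notin> \<real>\<^sub>\<le>\<^sub>0" using assms by (simp add: cut_plane_def)
  then have "z \<noteq> 0" by auto
  then have ez: "exp (Ln z) = z" by simp
  have w0: "\<bar>Im (Ln z)\<bar> < pi"
    using mpi_less_Im_Ln[OF \<open>z \<noteq> 0\<close>] Im_Ln_less_pi[OF z] by linarith
  have eq: "?K t = ?K' t" if "t \<in> {0<..} - {1}" for t using that by (simp add: \<rho>_strip_eq)
  \<comment> \<open>The two densities differ on the positive half-line at most at the null point t =
    1, so both integrals are compared with that point removed.\<close>
  have punctured: "set_integrable lborel {0<..} f = set_integrable lborel ({0<..} - {1}) f"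
    "set_lebesgue_integral lborel {0<..} f = set_lebesgue_integral lborel ({0<..} - {1}) f"
    for f :: "real \<Rightarrow> complex"
    by (rule set_integrable_discrete_difference[of "{1}"] set_integral_discrete_difference[of "{1}"]; auto)+
  have "set_integrable lborel {0<..} ?K = set_integrable lborel {0<..} ?K'"
    unfolding punctured using eq by (intro set_integrable_cong) auto
  moreover have "set_lebesgue_integral lborel {0<..} ?K = set_lebesgue_integral lborel {0<..} ?K'"
    unfolding punctured using eq by (intro set_lebesgue_integral_cong) auto
  ultimately show ?thesis
    using set_integrable_kernel[OF z] kernel_integral[OF w0] G_strip_eq[OF w0] ez by simp
qed

end
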